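(* Let $J,R,Q\in\mathbb R^{n\times n}$, $B\in\mathbb R^{n\times m}$ with $J^\top=-J$, $R=R^\top\succeq 0$, $Q=Q^\top\succ 0$ define a port-Hamiltonian system with $A=(J-R)Q$, $C=B^\top Q$, and assume that it is minimal, i.e. $(A,B)$ is controllable and $(A,C)$ is observable. Let $\widehat{\mathcal P}_{\mathrm c}$ and $\widehat{\mathcal P}_{\mathrm f}$ be the unique stabilizing solutions of $$A^\top \widehat{\mathcal P}_{\mathrm c}+\widehat{\mathcal P}_{\mathrm c}A-\widehat{\mathcal P}_{\mathrm c}BB^\top\widehat{\mathcal P}_{\mathrm c}+C^\top C=0,$$ $$A\widehat{\mathcal P}_{\mathrm f}+\widehat{\mathcal P}_{\mathrm f}A^\top-\widehat{\mathcal P}_{\mathrm f}C^\top C\widehat{\mathcal P}_{\mathrm f}+BB^\top+2R=0,$$ respectively. Then the associated LQG controller $\dot x_{\mathrm c}=\widehat A_{\mathrm c}x_{\mathrm c}+\widehat B_{\mathrm c}u_{\mathrm c}$, $y_{\mathrm c}=\widehat C_{\mathrm c}x_{\mathrm c}$, defined by $$\widehat A_{\mathrm c}=A-BB^\top\widehat{\mathcal P}_{\mathrm c}-\widehat{\mathcal P}_{\mathrm f}C^\top C,\qquad \widehat B_{\mathrm c}=\widehat{\mathcal P}_{\mathrm f}C^\top,\qquad \widehat C_{\mathrm c}=B^\top\widehat{\mathcal P}_{\mathrm c},$$ is port-Hamiltonian. In particular, with the Hamiltonian function $\mathcal H_{\mathrm c}(x_{\mathrm c})=\frac12 x_{\mathrm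 c}^\top\widehat{\mathcal P}_{\mathrm c}x_{\mathrm c}$, a port-Hamiltonian realization of the controller (that is, $\widehat A_{\mathrm c}=(\widehat J_{\mathrm c}-\widehat R_{\mathrm c})\widehat Q_{\mathrm c}$, $\widehat C_{\mathrm c}=\widehat B_{\mathrm c}^\top\widehat Q_{\mathrm c}$) is given by $$\widehat J_{\mathrm c}=\tfrac12\big(\widehat A_{\mathrm c}\widehat{\mathcal P}_{\mathrm c}^{-1}-\widehat{\mathcal P}_{\mathrm c}^{-1}\widehat A_{\mathrm c}^\top\big),\quad \widehat R_{\mathrm c}=\tfrac12\big(\widehat{\mathcal P}_{\mathrm c}^{-1}Q+I_n\big)BB^\top\big(\widehat{\mathcal P}_{\mathrm c}^{-1}Q+I_n\big)^\top,\quad \widehat Q_{\mathrm c}=\widehat{\mathcal P}_{\mathrm c},\quad \widehat B_{\mathrm c}=B.$$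
   Context: All matrices are real; $\succeq$, $\succ$ denote the Loewner order. A linear system $\dot x=\mathcal Ax+\mathcal Bu$, $y=\mathcal Cx$ is port-Hamiltonian (with Hamiltonian function $\frac12x^\top\mathcal Qx$) if there are matrices $\mathcal J=-\mathcal J^\top$, $\mathcal R=\mathcal R^\top\succeq0$, $\mathcal Q=\mathcal Q^\top\succ0$ with $\mathcal A=(\mathcal J-\mathcal R)\mathcal Q$ and $\mathcal C=\mathcal B^\top\mathcal Q$. A symmetric solution $\widehat{\mathcal P}_{\mathrm c}$ of the first (control) Riccati equation is stabilizing if all eigenvalues of $A-BB^\top\widehat{\mathcal P}_{\mathrm c}$ lie in the open left half plane; a symmetric solution $\widehat{\mathcal P}_{\mathrm f}$ of the second (filter) Riccati equation is stabilizing if all eigenvalues of $A-\widehat{\mathcal P}_{\mathrm f}C^\top C$ lie in the open left half plane. Under the minimality assumption these stabilizing solutions exist and are unique. *)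

theory Defs
  imports "HOL-Analysis.Analysis"
begin

definition pos_semidef :: "real^'n^'n \<Rightarrow> bool" where
  "pos_semidef M \<longleftrightarrow> transpose M = M \<and> (\<forall>x. 0 \<le> x \<bullet> (M *v x))"

definition pos_def :: "real^'n^'n \<Rightarrow> bool" where
  "pos_def M \<longleftrightarrow> transpose M = M \<and> (\<forall>x. x \<noteq> 0 \<longrightarrow> 0 < x \<bullet> (M *v x))"

text \<open>Eigenvalues of a real matrix are the complex ones.\<close>

definition eigenvalue :: "real^'n^'n \<Rightarrow> complex \<Rightarrow> bool" where
  "eigenvalue M l \<longleftrightarrow>
     (\<exists>v :: complex^'n. v \<noteq> 0 \<and> map_matrix complex_of_real M *v v = l *s v)"

definition hurwitz :: "real^'n^'n \<Rightarrow> bool" where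
  "hurwitz M \<longleftrightarrow> (\<forall>l. eigenvalue M l \<longrightarrow> Re l < 0)"

definition state_trajectory ::
  "real^'n^'n \<Rightarrow> real^'m^'n \<Rightarrow> real set \<Rightarrow> (real \<Rightarrow> real^'m) \<Rightarrow> (real \<Rightarrow> real^'n) \<Rightarrow> bool" where
  "state_trajectory A B I u x \<longleftrightarrow> continuous_on I u \<and>
     (\<forall>t\<in>I. (x has_vector_derivative (A *v x t + B *v u t)) (at t within I))"

text \<open>
  Every state can be steered to every other state in finite time. Inputs are continuous; for
  linear time-invariant systems, piecewise continuous or integrable inputs give the same notion.
\<close>

definition controllable :: "real^'n^'n \<Rightarrow> real^'m^'n \<Rightarrow> bool" where
  "controllable A B \<longleftrightarrow>
     (\<forall>x0 x1. \<exists>T>0. \<exists>u x. state_trajectory A B {0..T} u x \<and> x 0 = x0 \<and> x T = x1)"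

text \<open>
  The output determines the initial state. By linearity a common input cancels, so it is enough
  to compare solutions of the uncontrolled system.
\<close>

definition observable :: "real^'n^'n \<Rightarrow> real^'n^'p \<Rightarrow> bool" where
  "observable A C \<longleftrightarrow>
     (\<forall>x z. (\<forall>t\<ge>0. (x has_vector_derivative (A *v x t)) (at t within {0..})) \<and>
            (\<forall>t\<ge>0. (z has_vector_derivative (A *v z t)) (at t within {0..})) \<and>
            (\<forall>t\<ge>0. C *v x t = C *v z t) \<longrightarrow> x 0 = z 0)"

text \<open>
  The matrices \<open>J, R, Q\<close> give a port-Hamiltonian form, with Hamiltonian function \<open>H\<close>, of the
  system with state, input and output matrix \<open>A, B, C\<close>.
\<close>

definition pH_realization ::
  "(real^'n \<Rightarrow> real) \<Rightarrow> real^'n^'n \<Rightarrow> real^'n^'n \<Rightarrow> real^'n^'n \<Rightarrow>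
   real^'n^'n \<Rightarrow> real^'m^'n \<Rightarrow> real^'n^'m \<Rightarrow> bool" where
  "pH_realization H J R Q A B C \<longleftrightarrow>
     transpose J = - J \<and> pos_semidef R \<and> pos_def Q \<and>
     A = (J - R) ** Q \<and> C = transpose B ** Q \<and>
     H = (\<lambda>x. 1/2 * (x \<bullet> (Q *v x)))"

definition port_Hamiltonian ::
  "real^'n^'n \<Rightarrow> real^'m^'n \<Rightarrow> real^'n^'m \<Rightarrow> bool" where
  "port_Hamiltonian A B C \<longleftrightarrow> (\<exists>H J R Q. pH_realization H J R Q A B C)"

definition stabilizing_control_solution ::
  "real^'n^'n \<Rightarrow> real^'m^'n \<Rightarrow> real^'n^'m \<Rightarrow> real^'n^'n \<Rightarrow> bool" where
  "stabilizing_control_solution A B C P \<longleftrightarrow>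
     transpose P = P \<and>
     transpose A ** P + P ** A - P ** B ** transpose B ** P + transpose C ** C = 0 \<and>
     hurwitz (A - B ** transpose B ** P)"

definition stabilizing_filter_solution ::
  "real^'n^'n \<Rightarrow> real^'n^'n \<Rightarrow> real^'m^'n \<Rightarrow> real^'n^'m \<Rightarrow> real^'n^'n \<Rightarrow> bool" where
  "stabilizing_filter_solution R A B C P \<longleftrightarrow>
     transpose P = P \<and>
     A ** P + P ** transpose A - P ** transpose C ** C ** P
       + B ** transpose B + 2 *\<^sub>R R = 0 \<and>
     hurwitz (A - P ** transpose C ** C)"

end

theory Submission
  imports Defs "HOL-Computational_Algebra.Fundamental_Theorem_Algebra"
begin

text \<open>
  Because \<open>C = B\<^sup>T Q\<close> and the filter equation carries the extra term \<open>2 R\<close>, the matrix \<open>Q\<^sup>-\<^sup>1\<close> solves it, and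
  the energy balance together with observability shows that this solution is stabilizing. By
  uniqueness it equals the given one, so the controller input matrix is \<open>Q\<^sup>-\<^sup>1 C\<^sup>T = B\<close>. Observability
  also makes the control solution \<open>P\<close> positive definite; multiplying its Riccati equation by
  \<open>P\<^sup>-\<^sup>1\<close> from both sides identifies the symmetric part of \<open>A\<^sub>c P\<^sup>-\<^sup>1\<close> as \<open>- R\<^sub>c\<close>.

  Uniqueness and definiteness both rest on one fact: if \<open>M\<close> is Hurwitz and
  \<open>M\<^sup>T P + P M \<le> 0\<close>, then \<open>P \<ge> 0\<close>. It is proved without matrix exponentials, by comparing \<open>P\<close> with
  a strict Lyapunov form that is built from an annihilating product \<open>(M - l\<^sub>1) \<cdots> (M - l\<^sub>k)\<close>.
\<close>

subsection \<open>Annihilating products and eigenvectors\<close>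

text \<open>Horner's scheme for the vector p(M) v.\<close>

definition matrix_poly :: "complex^'n^'n \<Rightarrow> complex poly \<Rightarrow> complex^'n \<Rightarrow> complex^'n" where
  "matrix_poly M p v = fold_coeffs (\<lambda>a w. a *s v + M *v w) p 0"

lemma matrix_poly_0 [simp]: "matrix_poly M 0 v = 0"
  by (simp add: matrix_poly_def)

lemma matrix_poly_pCons [simp]:
  "matrix_poly M (pCons a p) v = a *s v + M *v matrix_poly M p v"
  \<comment> \<open>\<open>pCons 0 0\<close> is the zero polynomial, on which the fold takes no
    step, so that pair is treated apart.\<close>
  by (cases "p = 0 \<and> a = 0") (auto simp: matrix_poly_def)

lemma matrix_poly_add: "matrix_poly M (p + q) v = matrix_poly M p v + matrix_poly M q v"
  by (induction p q rule: poly_induct2)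
    (auto simp: vec.scale_left_distrib algebra_simps)

lemma matrix_poly_smult: "matrix_poly M (smult c p) v = c *s matrix_poly M p v"
  by (induction p) (auto simp: vec.scale_right_distrib vec.scale)

lemma matrix_poly_linear_factor:
  "matrix_poly M ([:-l, 1:] * q) v = M *v matrix_poly M q v - l *s matrix_poly M q v"
proof -
  have eq: "[:-l, 1:] * q = pCons 0 q + smult (- l) q"
    by simp
  show ?thesis
    unfolding eq matrix_poly_add matrix_poly_smult by simp
qed

lemma matrix_poly_monom: "matrix_poly M (monom c i) v = c *s ((*v) M ^^ i) v"
  by (induction i) (auto simp: monom_0 monom_Suc vec.scale)

lemma matrix_poly_sum: "matrix_poly M (sum f S) v = (\<Sum>i\<in>S. matrix_poly M (f i) v)"
  by (induction S rule: infinite_finite_induct) (auto simp: matrix_poly_add)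

text \<open>The head of the list acts first, so an induction over the list replaces \<open>v\<close>
  by (M - l) v.\<close>

fun root_product :: "complex^'n^'n \<Rightarrow> complex list \<Rightarrow> complex^'n \<Rightarrow> complex^'n" where
  "root_product M [] v = v"
| "root_product M (l # ls) v = root_product M ls (M *v v - l *s v)"

text \<open>Factors that are polynomials in the same matrix commute, so the first one can be moved
  to the outside.\<close>

lemma root_product_linear_factor:
  "root_product M ls (M *v v - l *s v) = M *v root_product M ls v - l *s root_product M ls v"
proof (induction ls arbitrary: v)
  case (Cons a ls)
  have "M *v (M *v v - l *s v) - a *s (M *v v - l *s v)
      = M *v (M *v v - a *s v) - l *s (M *v v - a *s v)"
    by (simp add: vec.diff vec.scale vec.scale_right_diff_distrib mult.commute algebra_simps)
  then show ?case
    using Cons[of "M *v v - a *s v"] by simp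
qed simp

text \<open>The fundamental theorem of algebra splits off one root at a time; the witness for
  \<open>c\<close> is the leading coefficient.\<close>

lemma matrix_poly_splits:
  assumes "p \<noteq> 0"
  shows "\<exists>ls c. c \<noteq> 0 \<and> (\<forall>v. matrix_poly M p v = c *s root_product M ls v)"
  using assms
proof (induction "degree p" arbitrary: p)
  case 0
  then obtain c where "p = [:c:]"
    using degree_eq_zeroE by metis
  with 0 show ?case
    by (intro exI[of _ "[]"] exI[of _ c]) auto
next
  case (Suc d)
  then have "\<not> constant (poly p)"
    by (simp add: constant_degree)
  then obtain l where "poly p l = 0"
    using fundamental_theorem_of_algebra by blast
  then obtain q where q: "p = [:-l, 1:] * q"
    by (auto simp: poly_eq_0_iff_dvd)
  with Suc have "q \<noteq> 0"
    by auto
  moreover have "degree q = d"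
    using Suc(2) \<open>q \<noteq> 0\<close> unfolding q by (subst (asm) degree_mult_eq) auto
  ultimately obtain ls c
    where c: "c \<noteq> 0" and ls: "\<And>v. matrix_poly M q v = c *s root_product M ls v"
    using Suc(1) by metis
  have "matrix_poly M p v = c *s root_product M (l # ls) v" for v
    unfolding q matrix_poly_linear_factor
    by (simp add: ls root_product_linear_factor vec.scale vec.scale_right_diff_distrib mult.commute)
  with c show ?case
    by blast
qed

text \<open>An infinite set in a finite-dimensional space is dependent. Indexing by position also
  covers repetitions, where f i - f j = 0 is the relation.\<close>

lemma sequence_dependent:
  fixes f :: "nat \<Rightarrow> 'a::euclidean_space"
  obtains c n k where "k \<le> n" "c k \<noteq> 0" "(\<Sum>i\<le>n. c i *\<^sub>R f i) = 0"
proof (cases "inj f")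
  case True
  then have "infinite (range f)"
    using finite_imageD by blast
  then have "dependent (range f)"
    using independent_bound by blast
  then obtain t u v where t: "finite t" "t \<subseteq> range f" "v \<in> t" "u v \<noteq> 0"
    and z: "(\<Sum>v\<in>t. u v *\<^sub>R v) = 0"
    unfolding dependent_explicit by auto
  define s where "s = f -` t"
  have s: "finite s" "f ` s = t"
    using t True by (auto simp: s_def finite_vimageI)
  obtain n where n: "s \<subseteq> {..n}"
    using s(1) by (meson finite_nat_iff_bounded_le)
  obtain k where k: "k \<in> s" "f k = v"
    using s t by blast
  have "(\<Sum>i\<le>n. (if i \<in> s then u (f i) else 0) *\<^sub>R f i) = (\<Sum>i\<in>s. u (f i) *\<^sub>R f i)"
    using n by (intro sum.mono_neutral_cong_right) auto
  also have "\<dots> = (\<Sum>v\<in>f ` s. u v *\<^sub>R v)"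
    using True by (subst sum.reindex) (auto intro: inj_on_subset)
  finally have "(\<Sum>i\<le>n. (if i \<in> s then u (f i) else 0) *\<^sub>R f i) = 0"
    using z s by simp
  then show ?thesis
    using that[of k n "\<lambda>i. if i \<in> s then u (f i) else 0"] k n t by auto
next
  case False
  then obtain i j where ij: "i < j" "f i = f j"
    unfolding inj_def by (metis linorder_neqE_nat)
  define c where "c = (\<lambda>k. if k = i then 1 else if k = j then -1 else 0 :: real)"
  have "(\<Sum>k\<le>j. c k *\<^sub>R f k) = (\<Sum>k\<in>{i, j}. c k *\<^sub>R f k)"
    using ij by (intro sum.mono_neutral_right) (auto simp: c_def)
  also have "\<dots> = 0"
    using ij by (simp add: c_def)
  finally show ?thesis
    using that[of i j c] ij by (simp add: c_def)
qed

text \<open>The powers of \<open>M\<close> lie in a finite-dimensional real space, so a linear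
  relation among them is a nonzero polynomial that vanishes at \<open>M\<close>; its roots form the
  list.\<close>

lemma annihilating_roots:
  fixes M :: "complex^'n^'n"
  obtains ls where "\<And>v. root_product M ls v = 0"
proof -
  define pow where "pow i = (((**) M) ^^ i) (mat 1)" for i
  have pow: "pow i *v v = ((*v) M ^^ i) v" for i v
    by (induction i) (auto simp: pow_def matrix_vector_mul_assoc[symmetric])
  \<comment> \<open>The relation is taken among the matrices and not among the vectors M^i v, so one
    list serves every \<open>v\<close>.\<close>
  obtain c n k where ck: "k \<le> n" "c k \<noteq> 0" and z: "(\<Sum>i\<le>n. c i *\<^sub>R pow i) = 0"
    by (rule sequence_dependent)
  define p where "p = (\<Sum>i\<le>n. monom (complex_of_real (c i)) i)"
  have "coeff p k = complex_of_real (c k)"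
    using ck by (simp add: p_def coeff_sum)
  with ck have "p \<noteq> 0"
    by auto
  have scale: "complex_of_real a *s v = a *\<^sub>R v" for a and v :: "complex^'n"
    by (subst vec_eq_iff) (simp add: scaleR_conv_of_real[where 'a = complex])
  have lin: "linear (\<lambda>X :: complex^'n^'n. X *v v)" for v :: "complex^'n"
  proof (rule linearI)
    show "(c *\<^sub>R X) *v v = c *\<^sub>R (X *v v)" for c :: real and X :: "complex^'n^'n"
      by (simp add: matrix_vector_mult_def vec_eq_iff scaleR_sum_right)
    show "(X + Y) *v v = X *v v + Y *v v" for X Y :: "complex^'n^'n"
      by (rule matrix_vector_mult_add_rdistrib)
  qed
  have "matrix_poly M p v = 0" for v
  proof -
    have "matrix_poly M p v = (\<Sum>i\<le>n. c i *\<^sub>R (pow i *v v))"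
      by (simp add: p_def matrix_poly_sum matrix_poly_monom scale pow)
    also have "\<dots> = (\<Sum>i\<le>n. c i *\<^sub>R pow i) *v v"
      by (simp add: linear_sum[OF lin] linear_scale[OF lin])
    finally show ?thesis
      by (simp add: z)
  qed
  then show ?thesis
    using matrix_poly_splits[OF \<open>p \<noteq> 0\<close>, of M] that by fastforce
qed

text \<open>Apply the factors of an annihilating product to \<open>v\<close> one by one: the last
  nonzero vector is an eigenvector, and it has not left \<open>V\<close>.\<close>

lemma eigenvector_in_invariant_set:
  fixes M :: "complex^'n^'n"
  assumes "v \<in> V" "v \<noteq> 0" and inv: "\<And>v l. v \<in> V \<Longrightarrow> M *v v - l *s v \<in> V"
  obtains w l where "w \<in> V" "w \<noteq> 0" "M *v w = l *s w"
proof -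
  obtain ls where ls: "root_product M ls v = 0"
    using annihilating_roots by metis
  have "\<exists>w l. w \<in> V \<and> w \<noteq> 0 \<and> M *v w = l *s w"
    using ls assms(1,2)
  proof (induction ls arbitrary: v)
    case (Cons l ls)
    show ?case
    proof (cases "M *v v - l *s v = 0")
      case True
      with Cons.prems show ?thesis
        by auto
    next
      case False
      then show ?thesis
        using Cons.IH[of "M *v v - l *s v"] Cons.prems inv by simp
    qed
  qed simp
  then show ?thesis
    using that by blast
qed

text \<open>If \<open>l\<close> is not an eigenvalue then M - l is injective, so this factor can be
  cancelled from an annihilating product.\<close>

lemma annihilating_eigenvalues:
  fixes M :: "complex^'n^'n"
  obtains ls where "\<And>l. l \<in> set ls \<Longrightarrow> \<exists>w. w \<noteq> 0 \<and> M *v w = l *s w"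
    and "\<And>v. root_product M ls v = 0"
proof -
  define E where "E = (\<lambda>l. \<exists>w. w \<noteq> 0 \<and> M *v w = l *s w)"
  have filter: "root_product M ls v = 0 \<Longrightarrow> root_product M (filter E ls) v = 0" for ls v
  proof (induction ls arbitrary: v)
    case (Cons l ls)
    show ?case
    proof (cases "E l")
      case True
      then show ?thesis
        using Cons by simp
    next
      case False
      then have "root_product M ls v = 0"
        using Cons.prems by (auto simp: E_def root_product_linear_factor)
      with False Cons.IH show ?thesis
        by simp
    qed
  qed simp
  obtain ls where "\<And>v. root_product M ls v = 0"
    using annihilating_roots by metis
  then show ?thesis
    using that[of "filter E ls"] filter by (auto simp: E_def)
qed

subsection \<open>Lyapunov forms\<close>

text \<open>The inner product on complex vectors is the real part of the Hermitian one, for which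
  multiplication by i is skew.\<close>

lemma inner_vector_scalar_mult:
  fixes x :: "complex^'n"
  shows "x \<bullet> (l *s x) = Re l * (x \<bullet> x)"
  by (simp add: inner_vec_def inner_complex_def sum_distrib_left algebra_simps)

text \<open>The form for \<open>l # ls\<close> is
  \<open>\<bar>x\<bar>\<^sup>2 / a + V ((M - l) x) / a\<^sup>2\<close> with \<open>a = - Re l\<close> and \<open>V\<close> the form for \<open>ls\<close>;
  by Young's inequality the derivative of the first term absorbs the defect \<open>\<bar>(M - l) x\<bar>\<^sup>2\<close>.\<close>

lemma lyapunov_form_root_product:
  fixes M :: "complex^'n^'n"
  assumes "\<And>l. l \<in> set ls \<Longrightarrow> Re l < 0"
  shows "\<exists>b K. bilinear b \<and> (\<forall>x y. b x y = b y x) \<and> (\<forall>x. 0 \<le> b x x) \<and>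
    (\<forall>x. 2 * b x (M *v x) \<le> K * (root_product M ls x \<bullet> root_product M ls x) - x \<bullet> x)"
  using assms
proof (induction ls)
  case Nil
  have "bilinear (\<lambda>x y :: complex^'n. 0 :: real)"
    by (simp add: bilinear_def linear_zero)
  then show ?case
    \<comment> \<open>The empty product returns \<open>x\<close> itself, so with K = 1 the
      right-hand side is zero.\<close>
    by (intro exI[of _ "\<lambda>x y. 0"] exI[of _ 1]) simp
next
  case (Cons l ls)
  then obtain b K where b: "bilinear b" "\<And>x y. b x y = b y x" "\<And>x. 0 \<le> b x x"
    and lyap: "\<And>x. 2 * b x (M *v x) \<le> K * (root_product M ls x \<bullet> root_product M ls x) - x \<bullet> x"
    by auto
  define a where "a = - Re l"
  have a: "a > 0"
    using Cons.prems by (simp add: a_def)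
  define N where "N = (\<lambda>x. M *v x - l *s x)"
  have N: "linear N"
  proof -
    have "N = (\<lambda>x. (M - mat l) *v x)"
      unfolding N_def fun_eq_iff
      by (simp add: matrix_vector_mult_diff_rdistrib)
        (simp add: vec_eq_iff matrix_vector_mult_def mat_def if_distrib if_distribR cong: if_cong)
    then show ?thesis
      by simp
  qed
  define b' where "b' = (\<lambda>x y. (1/a) * (x \<bullet> y) + (1/a\<^sup>2) * b (N x) (N y))"
  have "bilinear b'"
    unfolding bilinear_def b'_def
    by (intro allI conjI linearI)
      (simp_all add: linear_add[OF N] linear_scale[OF N] bilinear_ladd[OF b(1)] bilinear_radd[OF b(1)]
        bilinear_lmul[OF b(1)] bilinear_rmul[OF b(1)] algebra_simps)
  moreover have "b' x y = b' y x" for x y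
    by (simp add: b'_def inner_commute b(2)[of "N x"])
  moreover have "0 \<le> b' x x" for x
    using a b(3) by (simp add: b'_def)
  moreover have "2 * b' x (M *v x)
      \<le> (K / a\<^sup>2) * (root_product M (l # ls) x \<bullet> root_product M (l # ls) x) - x \<bullet> x" for x
  proof -
    define y where "y = N x"
    have My: "N (M *v x) = M *v y"
      by (simp add: y_def N_def vec.diff vec.scale)
    have Mx: "M *v x = y + l *s x"
      by (simp add: y_def N_def)
    have "0 \<le> (a *\<^sub>R x - y) \<bullet> (a *\<^sub>R x - y)"
      by simp
    then have "2 * a * (x \<bullet> y) \<le> a\<^sup>2 * (x \<bullet> x) + y \<bullet> y"
      by (simp add: inner_diff_left inner_diff_right inner_commute power2_eq_square algebra_simps)
    then have "2 * a * (x \<bullet> y) / a\<^sup>2 \<le> (a\<^sup>2 * (x \<bullet> x) + y \<bullet> y) / a\<^sup>2"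
      by (rule divide_right_mono) simp
    then have young: "2 * (x \<bullet> y) / a \<le> x \<bullet> x + (y \<bullet> y) / a\<^sup>2"
      using a by (simp add: add_divide_distrib power2_eq_square)
    have "2 * b y (M *v y) / a\<^sup>2 \<le> (K * (root_product M ls y \<bullet> root_product M ls y) - y \<bullet> y) / a\<^sup>2"
      using lyap[of y] by (rule divide_right_mono) simp
    \<comment> \<open>Since Re l = - a, the part l x of M x contributes -2 |x|^2: one half pays for
      Young's inequality, the other remains as decrease.\<close>
    moreover have "2 * b' x (M *v x) = 2 * (x \<bullet> y) / a - 2 * (x \<bullet> x) + 2 * b y (M *v y) / a\<^sup>2"
      unfolding b'_def My y_def[symmetric]
      using a by (simp add: Mx inner_add_right inner_vector_scalar_mult field_simps)
        (simp add: a_def algebra_simps)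
    moreover have "root_product M (l # ls) x = root_product M ls y"
      by (simp add: y_def N_def)
    ultimately show ?thesis
      using young by (simp add: diff_divide_distrib)
  qed
  ultimately show ?case
    by blast
qed

text \<open>The degenerate case of Cauchy-Schwarz: otherwise the form would be negative at x - t y
  for a suitable \<open>t\<close>.\<close>

lemma psd_form_kernel:
  fixes b :: "'a::real_vector \<Rightarrow> 'a \<Rightarrow> real"
  assumes b: "bilinear b" and sym: "\<And>x y. b x y = b y x" and psd: "\<And>x. 0 \<le> b x x"
    and x: "b x x = 0"
  shows "b x y = 0"
proof -
  \<comment> \<open>Adding 1 keeps the denominator positive even if \<open>b y y\<close> is
    zero.\<close>
  define t where "t = b x y / (b y y + 1)"
  have c: "b y y + 1 > 0"
    using psd[of y] by linarith
  then have txy: "b x y = t * (b y y + 1)"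
    by (simp add: t_def)
  have "0 \<le> b (x - t *\<^sub>R y) (x - t *\<^sub>R y)"
    by (rule psd)
  also have "\<dots> = - 2 * t * b x y + t\<^sup>2 * b y y"
    by (simp add: bilinear_lsub[OF b] bilinear_rsub[OF b] bilinear_lmul[OF b] bilinear_rmul[OF b]
        x sym[of y x] power2_eq_square algebra_simps)
  also have "\<dots> = - (t\<^sup>2 * (b y y + 2))"
    by (simp add: txy power2_eq_square algebra_simps)
  finally have "t\<^sup>2 * (b y y + 2) \<le> 0"
    by simp
  with psd[of y] have "t = 0"
    by (auto simp: mult_le_0_iff)
  then show ?thesis
    by (simp add: txy)
qed

section \<open>Real vectors inside the complex space\<close>

definition complex_vec :: "real^'n \<Rightarrow> complex^'n" where
  "complex_vec x = (\<chi> i. complex_of_real (x $ i))"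

lemma linear_complex_vec: "linear complex_vec"
  by (rule linearI) (simp_all add: complex_vec_def vec_eq_iff scaleR_conv_of_real[where 'a = complex])

lemma complex_vec_matrix_vector_mult:
  "complex_vec (M *v x) = map_matrix complex_of_real M *v complex_vec x"
  by (simp add: complex_vec_def vec_eq_iff matrix_vector_mult_def)

lemma inner_complex_vec: "complex_vec x \<bullet> complex_vec y = x \<bullet> y"
  by (simp add: complex_vec_def inner_vec_def inner_complex_def)

text \<open>For a Hurwitz matrix every root in the annihilating list may be an eigenvalue with
  negative real part; the defect term then vanishes, and the complex form is restricted to real
  vectors.\<close>

lemma hurwitz_lyapunov_form:
  fixes M :: "real^'n^'n"
  assumes "hurwitz M"
  obtains b :: "real^'n \<Rightarrow> real^'n \<Rightarrow> real" where "bilinear b" "\<And>x y. b x y = b y x"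
    "\<And>x. x \<noteq> 0 \<Longrightarrow> 0 < b x x" "\<And>x. 2 * b x (M *v x) \<le> - (x \<bullet> x)"
proof -
  let ?M = "map_matrix complex_of_real M"
  obtain ls where ls: "\<And>l. l \<in> set ls \<Longrightarrow> \<exists>w. w \<noteq> 0 \<and> ?M *v w = l *s w"
    and z: "\<And>v. root_product ?M ls v = 0"
    using annihilating_eigenvalues[of ?M] by metis
  have "Re l < 0" if "l \<in> set ls" for l
    using ls[OF that] assms by (auto simp: hurwitz_def eigenvalue_def)
  from lyapunov_form_root_product[of ls ?M, OF this] z
  obtain b where b: "bilinear b" "\<And>x y. b x y = b y x" "\<And>x. 0 \<le> b x x"
    and lyap: "\<And>x. 2 * b x (?M *v x) \<le> - (x \<bullet> x)"
    by auto
  define r where "r = (\<lambda>x y. b (complex_vec x) (complex_vec y))"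
  have "bilinear r"
    unfolding r_def bilinear_def
    using b(1) linear_compose[OF linear_complex_vec] unfolding bilinear_def o_def by blast
  moreover have sym: "r x y = r y x" for x y
    unfolding r_def by (rule b(2))
  moreover have decr: "2 * r x (M *v x) \<le> - (x \<bullet> x)" for x
    using lyap[of "complex_vec x"]
    by (simp add: r_def complex_vec_matrix_vector_mult inner_complex_vec)
  moreover have "0 < r x x" if "x \<noteq> 0" for x
  proof -
    \<comment> \<open>A vector in the kernel of the form would have derivative zero, against the
      strict decrease.\<close>
    have "r x x \<noteq> 0"
    proof
      assume "r x x = 0"
      have "r x (M *v x) = 0"
        by (rule psd_form_kernel[OF \<open>bilinear r\<close> sym _ \<open>r x x = 0\<close>]) (simp add: r_def b(3))
      moreover have "0 < x \<bullet> x"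
        using that by simp
      ultimately show False
        using decr[of x] by linarith
    qed
    then show ?thesis
      using b(3)[of "complex_vec x"] by (simp add: r_def less_le)
  qed
  ultimately show ?thesis
    using that by blast
qed

lemma inner_matrix_transpose: "x \<bullet> (A *v y) = (transpose A *v x) \<bullet> (y :: real^'n)"
  by (simp add: dot_lmul_matrix)

lemma bilinear_matrix: "bilinear (\<lambda>x y. x \<bullet> ((P :: real^'n^'n) *v y))"
  unfolding bilinear_def
  by (intro allI conjI linearI) (simp_all add: inner_add_left inner_add_right algebra_simps)

text \<open>If \<open>\<mu> < 0\<close> were the minimum of \<open>x \<bullet> P x / b x x\<close>, attained at \<open>u\<close>, then \<open>u\<close> would be in the
  kernel of the positive semidefinite form \<open>P - \<mu> b\<close>, although that form strictly decreases
  at \<open>u\<close> along \<open>M u\<close>.\<close>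

lemma lyapunov_nonneg:
  fixes M P :: "real^'n^'n"
  assumes "hurwitz M" and P: "transpose P = P" and decr: "\<And>x. x \<bullet> (P *v (M *v x)) \<le> 0"
  shows "0 \<le> x \<bullet> (P *v x)"
proof (rule ccontr)
  assume neg: "\<not> 0 \<le> x \<bullet> (P *v x)"
  then have x: "x \<noteq> 0"
    by auto
  obtain b :: "real^'n \<Rightarrow> real^'n \<Rightarrow> real" where b: "bilinear b" "\<And>x y. b x y = b y x"
    and pos: "\<And>x. x \<noteq> 0 \<Longrightarrow> 0 < b x x" and lyap: "\<And>x. 2 * b x (M *v x) \<le> - (x \<bullet> x)"
    using hurwitz_lyapunov_form[OF assms(1)] by metis
  define f where "f = (\<lambda>x. (x \<bullet> (P *v x)) / b x x)"
  have "continuous_on (sphere 0 1) f"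
    unfolding f_def
  proof (intro continuous_on_divide)
    show "continuous_on (sphere 0 1) (\<lambda>x. x \<bullet> (P *v x))"
      by (intro bilinear_continuous_on_compose[OF _ _ bilinear_matrix] continuous_on_id)
    show "continuous_on (sphere 0 1) (\<lambda>x. b x x)"
      by (intro bilinear_continuous_on_compose[OF _ _ b(1)] continuous_on_id)
    show "\<forall>x\<in>sphere 0 1. b x x \<noteq> 0"
      using pos by (metis dist_self less_irrefl mem_sphere zero_neq_one)
  qed
  moreover have xs: "x /\<^sub>R norm x \<in> sphere 0 1"
    using x by simp
  ultimately obtain u where u: "u \<in> sphere 0 1" "\<And>v. v \<in> sphere 0 1 \<Longrightarrow> f u \<le> f v"
    using continuous_attains_inf[of "sphere 0 1" f] by fastforce
  then have "u \<noteq> 0"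
    by auto
  define g where "g = (\<lambda>x y. x \<bullet> (P *v y) - f u * b x y)"
  have g: "bilinear g"
    unfolding g_def bilinear_def
    by (intro allI conjI linearI)
      (simp_all add: bilinear_ladd[OF bilinear_matrix] bilinear_radd[OF bilinear_matrix]
        bilinear_lmul[OF bilinear_matrix] bilinear_rmul[OF bilinear_matrix]
        bilinear_ladd[OF b(1)] bilinear_radd[OF b(1)]
        bilinear_lmul[OF b(1)] bilinear_rmul[OF b(1)] algebra_simps)
  have "g v w = g w v" for v w
    using inner_matrix_transpose[of v P w] by (simp add: g_def b(2)[of v] P inner_commute)
  moreover have "0 \<le> g v v" for v
  proof (cases "v = 0")
    case False
    \<comment> \<open>The minimum was taken on the unit sphere; homogeneity of degree two carries it
      to all vectors.\<close>
    define w where "w = v /\<^sub>R norm v"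
    have w: "w \<in> sphere 0 1" "w \<noteq> 0" "v = norm v *\<^sub>R w"
      using False by (auto simp: w_def)
    have "f u * b w w \<le> f w * b w w"
      using u(2)[OF w(1)] pos[OF w(2)] by (intro mult_right_mono) auto
    then have "0 \<le> g w w"
      using pos[OF w(2)] by (simp add: g_def f_def)
    moreover have "g v v = (norm v)\<^sup>2 * g w w"
      by (subst (1 2) w(3)) (simp only: bilinear_lmul[OF g] bilinear_rmul[OF g], simp add: power2_eq_square)
    ultimately show ?thesis
      by simp
  qed (simp add: bilinear_lzero[OF g])
  moreover have "g u u = 0"
    using pos[OF \<open>u \<noteq> 0\<close>] by (simp add: g_def f_def)
  ultimately have "g u (M *v u) = 0"
    by (rule psd_form_kernel[OF g])
  moreover have "f u < 0"
  proof -
    have "f x < 0"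
      using neg pos[OF x] by (simp add: f_def divide_neg_pos)
    moreover have "f (x /\<^sub>R norm x) = f x"
      using x by (simp add: f_def bilinear_lmul[OF b(1)] bilinear_rmul[OF b(1)]
          matrix_vector_mult_scaleR)
    ultimately show ?thesis
      using u(2)[OF xs] by simp
  qed
  moreover have "b u (M *v u) < 0"
    using lyap[of u] \<open>u \<noteq> 0\<close> by (smt (verit) inner_gt_zero_iff)
  \<comment> \<open>The kernel property says that u . P M u equals
    \<open>f u * b u (M *v u)\<close>, a product of two negative numbers.\<close>
  ultimately show False
    using decr[of u] mult_neg_neg[of "f u" "b u (M *v u)"] by (simp add: g_def)
qed

subsection \<open>Observability\<close>

definition Re_vec :: "complex^'n \<Rightarrow> real^'n" where
  "Re_vec v = (\<chi> i. Re (v $ i))"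

definition Im_vec :: "complex^'n \<Rightarrow> real^'n" where
  "Im_vec v = (\<chi> i. Im (v $ i))"

lemma Re_Im_vec_matrix_vector_mult:
  "Re_vec (map_matrix complex_of_real M *v v) = M *v Re_vec v"
  "Im_vec (map_matrix complex_of_real M *v v) = M *v Im_vec v"
  by (simp_all add: Re_vec_def Im_vec_def vec_eq_iff matrix_vector_mult_def)

lemma Re_Im_vec_scale:
  "Re_vec (l *s v) = Re l *\<^sub>R Re_vec v - Im l *\<^sub>R Im_vec v"
  "Im_vec (l *s v) = Re l *\<^sub>R Im_vec v + Im l *\<^sub>R Re_vec v"
  by (simp_all add: Re_vec_def Im_vec_def vec_eq_iff)

lemma Re_Im_vec_diff:
  "Re_vec (v - w) = Re_vec v - Re_vec w"
  "Im_vec (v - w) = Im_vec v - Im_vec w"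
  by (simp_all add: Re_vec_def Im_vec_def vec_eq_iff)

lemma complex_vec_eq_0_iff: "v = 0 \<longleftrightarrow> Re_vec v = 0 \<and> Im_vec v = 0"
  by (auto simp: Re_vec_def Im_vec_def vec_eq_iff complex_eq_iff)

lemma Re_Im_vec_complex_vec [simp]: "Re_vec (complex_vec x) = x" "Im_vec (complex_vec x) = 0"
  by (simp_all add: Re_vec_def Im_vec_def complex_vec_def vec_eq_iff)

lemma eigenvector_Re_Im:
  assumes "map_matrix complex_of_real M *v v = l *s v"
  shows "M *v Re_vec v = Re l *\<^sub>R Re_vec v - Im l *\<^sub>R Im_vec v"
    and "M *v Im_vec v = Re l *\<^sub>R Im_vec v + Im l *\<^sub>R Re_vec v"
  using Re_Im_vec_matrix_vector_mult[of M v] by (simp_all add: assms Re_Im_vec_scale)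

text \<open>Here a + i b is an eigenvector for r + i w. It yields a real solution with zero output,
  which observability cannot tell from the zero solution.\<close>

lemma observable_no_oscillation:
  fixes A :: "real^'n^'n" and C :: "real^'n^'m"
  assumes obs: "observable A C"
    and Aa: "A *v a = r *\<^sub>R a - w *\<^sub>R b" and Ab: "A *v b = r *\<^sub>R b + w *\<^sub>R a"
    and Ca: "C *v a = 0" and Cb: "C *v b = 0"
  shows "a = 0"
proof -
  define c s where "c t = exp (r * t) * cos (w * t)" and "s t = exp (r * t) * sin (w * t)" for t
  \<comment> \<open>The real part of exp((r + i w) t) (a + i b).\<close>
  define x where "x t = c t *\<^sub>R a - s t *\<^sub>R b" for t
  have "(x has_vector_derivative A *v x t) (at t within S)" for t S
  proof -
    have c: "(c has_real_derivative r * c t - w * s t) (at t within S)"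
      unfolding c_def s_def by (auto intro!: derivative_eq_intros simp: algebra_simps)
    have s: "(s has_real_derivative r * s t + w * c t) (at t within S)"
      unfolding c_def s_def by (auto intro!: derivative_eq_intros simp: algebra_simps)
    have "(x has_vector_derivative
        (r * c t - w * s t) *\<^sub>R a - (r * s t + w * c t) *\<^sub>R b) (at t within S)"
      using has_vector_derivative_diff[OF
          has_vector_derivative_scaleR[OF c has_vector_derivative_const]
          has_vector_derivative_scaleR[OF s has_vector_derivative_const]]
      by (simp add: x_def[abs_def])
    also have "(r * c t - w * s t) *\<^sub>R a - (r * s t + w * c t) *\<^sub>R b = A *v x t"
      by (simp add: x_def matrix_vector_mult_scaleR matrix_vector_mult_diff_distrib Aa Ab
          scaleR_diff_left scaleR_add_left scaleR_diff_right scaleR_add_right mult.commute)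
    finally show ?thesis .
  qed
  moreover have "C *v x t = 0" for t
    by (simp add: x_def matrix_vector_mult_scaleR matrix_vector_mult_diff_distrib Ca Cb)
  moreover have "((\<lambda>t. 0 :: real^'n) has_vector_derivative A *v 0) (at t within S)" for t S
    by simp
  ultimately have "x 0 = 0"
    using obs[unfolded observable_def, rule_format, of x "\<lambda>t. 0"] by simp
  then show ?thesis
    by (simp add: x_def c_def s_def)
qed

text \<open>The Hautus test: no eigenvector of \<open>A\<close> is invisible in the output.\<close>

lemma observable_eigenvector:
  fixes A :: "real^'n^'n" and C :: "real^'n^'m"
  assumes obs: "observable A C"
    and Av: "map_matrix complex_of_real A *v v = l *s v"
    and C: "C *v Re_vec v = 0" "C *v Im_vec v = 0"
  shows "v = 0"
proof -
  note AA = eigenvector_Re_Im[OF Av]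
  have "Re_vec v = 0"
    using observable_no_oscillation[OF obs AA C] .
  \<comment> \<open>The same argument for the eigenvector - i v, whose real part is the imaginary
    part of \<open>v\<close>.\<close>
  moreover have "Im_vec v = 0"
    using observable_no_oscillation[OF obs, of "Im_vec v" "Re l" "Im l" "- Re_vec v"] AA C
    by (simp add: linear_neg[OF matrix_vector_mul_linear])
  ultimately show ?thesis
    by (simp add: complex_vec_eq_0_iff)
qed

text \<open>The complexified kernel of \<open>P\<close> is invariant under \<open>A\<close>, so if
  nontrivial it would contain an eigenvector that the Hautus test excludes.\<close>

lemma observable_invariant_kernel:
  fixes A :: "real^'n^'n" and C :: "real^'n^'m" and P :: "real^'n^'k"
  assumes obs: "observable A C"
    and inv: "\<And>x. P *v x = 0 \<Longrightarrow> P *v (A *v x) = 0"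
    and out: "\<And>x. P *v x = 0 \<Longrightarrow> C *v x = 0"
    and x: "P *v x = 0"
  shows "x = 0"
proof (rule ccontr)
  assume "x \<noteq> 0"
  define V where "V = {v. P *v Re_vec v = 0 \<and> P *v Im_vec v = 0}"
  have "complex_vec x \<in> V" "complex_vec x \<noteq> 0"
    using x \<open>x \<noteq> 0\<close> by (simp_all add: V_def complex_vec_eq_0_iff)
  moreover have "map_matrix complex_of_real A *v v - l *s v \<in> V" if "v \<in> V" for v l
    using that by (simp add: V_def Re_Im_vec_diff Re_Im_vec_scale Re_Im_vec_matrix_vector_mult inv
        matrix_vector_mult_diff_distrib matrix_vector_right_distrib matrix_vector_mult_scaleR)
  ultimately obtain w l where "w \<in> V" "w \<noteq> 0" "map_matrix complex_of_real A *v w = l *s w"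
    by (rule eigenvector_in_invariant_set)
  then show False
    using observable_eigenvector[OF obs] out by (auto simp: V_def)
qed

text \<open>In the energy given by \<open>Q\<close>, an eigenvector of \<open>G\<close> with Re l >=
  0 has zero output. There \<open>G\<close> agrees with \<open>A\<close>, so the Hautus test
  applies.\<close>

lemma hurwitz_if_dissipative:
  fixes A G Q :: "real^'n^'n" and C :: "real^'n^'m"
  assumes obs: "observable A C" and Q: "pos_def Q"
    and diss: "\<And>x. x \<bullet> (Q *v (G *v x)) \<le> - ((C *v x) \<bullet> (C *v x))"
    and out: "\<And>x. C *v x = 0 \<Longrightarrow> G *v x = A *v x"
  shows "hurwitz G"
  unfolding hurwitz_def eigenvalue_def
proof (intro allI impI, elim exE conjE)
  fix l v
  assume "v \<noteq> 0" and v: "map_matrix complex_of_real G *v v = l *s v"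
  define a b where "a = Re_vec v" and "b = Im_vec v"
  note G = eigenvector_Re_Im[OF v, folded a_def b_def]
  have Qpos: "0 \<le> x \<bullet> (Q *v x)" for x
    using Q by (cases "x = 0") (auto simp: pos_def_def less_imp_le)
  have Qsym: "a \<bullet> (Q *v b) = b \<bullet> (Q *v a)"
    using Q inner_matrix_transpose[of a Q b] by (simp add: pos_def_def inner_commute)
  \<comment> \<open>Adding both parts cancels the terms with Im l, because \<open>Q\<close> is
    symmetric.\<close>
  have "a \<bullet> (Q *v (G *v a)) + b \<bullet> (Q *v (G *v b)) = Re l * (a \<bullet> (Q *v a) + b \<bullet> (Q *v b))"
    by (simp add: G matrix_vector_mult_diff_distrib matrix_vector_right_distrib
        matrix_vector_mult_scaleR inner_diff_right inner_add_right Qsym algebra_simps)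
  then have le: "Re l * (a \<bullet> (Q *v a) + b \<bullet> (Q *v b))
      \<le> - ((C *v a) \<bullet> (C *v a)) - ((C *v b) \<bullet> (C *v b))"
    using diss[of a] diss[of b] by linarith
  show "Re l < 0"
  proof (rule ccontr)
    assume "\<not> Re l < 0"
    then have "0 \<le> Re l * (a \<bullet> (Q *v a) + b \<bullet> (Q *v b))"
      using Qpos by simp
    with le have "(C *v a) \<bullet> (C *v a) = 0" "(C *v b) \<bullet> (C *v b) = 0"
      using inner_ge_zero[of "C *v a"] inner_ge_zero[of "C *v b"] by linarith+
    then have C: "C *v a = 0" "C *v b = 0"
      by simp_all
    have "Re_vec (map_matrix complex_of_real A *v v) = Re_vec (l *s v)"
      "Im_vec (map_matrix complex_of_real A *v v) = Im_vec (l *s v)"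
      using G out[OF C(1)] out[OF C(2)]
      by (simp_all add: Re_Im_vec_matrix_vector_mult Re_Im_vec_scale a_def b_def)
    then have "map_matrix complex_of_real A *v v - l *s v = 0"
      by (subst complex_vec_eq_0_iff) (simp add: Re_Im_vec_diff)
    then show False
      using observable_eigenvector[OF obs, of v l] C \<open>v \<noteq> 0\<close> by (simp add: a_def b_def)
  qed
qed

text \<open>Transposition preserves \<open>det\<close>; this criterion is how stability passes to
  the transpose.\<close>

lemma eigenvalue_iff_det:
  "eigenvalue M l \<longleftrightarrow> det (map_matrix complex_of_real M - mat l) = 0"
proof -
  have mat: "mat l *v v = l *s v" for v :: "complex^'n"
    by (simp add: vec_eq_iff matrix_vector_mult_def mat_def if_distrib if_distribR cong: if_cong)
  have "eigenvalue M l \<longleftrightarrow> \<not> (\<forall>v. (map_matrix complex_of_real M - mat l) *v v = 0 \<longrightarrow> v = 0)"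
    by (auto simp: eigenvalue_def matrix_vector_mult_diff_rdistrib mat)
  also have "\<dots> \<longleftrightarrow> det (map_matrix complex_of_real M - mat l) = 0"
    unfolding matrix_left_invertible_ker[symmetric] invertible_left_inverse[symmetric]
      invertible_det_nz by simp
  finally show ?thesis .
qed

lemma hurwitz_transpose: "hurwitz M \<Longrightarrow> hurwitz (transpose M)"
proof -
  have "map_matrix complex_of_real (transpose M) - mat l
      = transpose (map_matrix complex_of_real M - mat l)" for l
    by (simp add: vec_eq_iff transpose_def mat_def)
  then show "hurwitz (transpose M)" if "hurwitz M"
    using that by (simp add: hurwitz_def eigenvalue_iff_det det_transpose)
qed

subsection \<open>Riccati equations\<close>

lemma transpose_add_diff_minus:
  fixes A B :: "real^'n^'m"
  shows "transpose (A + B) = transpose A + transpose B"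
    and "transpose (A - B) = transpose A - transpose B"
    and "transpose (- A) = - transpose A"
  by (simp_all add: transpose_def vec_eq_iff)

lemma minus_matrix_vector_mult: "(- A) *v x = - (A *v (x :: real^'n))"
  by (simp add: matrix_vector_mult_def vec_eq_iff sum_negf)

text \<open>Applied to a vector, a noncommutative matrix identity becomes a linear one between
  nested applications. Its uses often delete \<open>transpose_matrix_vector\<close>, which would
  turn transposes into products from the left.\<close>

lemmas apply_matrix =
  matrix_vector_mul_assoc[symmetric] matrix_vector_mult_add_rdistrib matrix_vector_mult_diff_rdistrib
  minus_matrix_vector_mult
  matrix_vector_right_distrib matrix_vector_mult_diff_distrib matrix_vector_mult_scaleR
  linear_neg[OF matrix_vector_mul_linear]

lemma inner_symmetric_matrix:
  "transpose P = P \<Longrightarrow> x \<bullet> (P *v y) = (P *v x) \<bullet> (y :: real^'n)"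
  using inner_matrix_transpose[of x P y] by simp

lemma pos_def_invertible:
  assumes "pos_def P" shows "invertible P"
  unfolding invertible_left_inverse matrix_left_invertible_ker
  using assms unfolding pos_def_def by (metis inner_zero_right less_irrefl)

lemma matrix_inv_inverse:
  assumes "invertible (P :: real^'n^'n)"
  shows "P ** matrix_inv P = mat 1" "matrix_inv P ** P = mat 1"
  using someI_ex[OF assms[unfolded invertible_def]] by (simp_all add: matrix_inv_def)

lemma matrix_inv_symmetric:
  assumes P: "invertible (P :: real^'n^'n)" and sym: "transpose P = P"
  shows "transpose (matrix_inv P) = matrix_inv P"
proof -
  have "transpose (matrix_inv P) = transpose (matrix_inv P) ** (P ** matrix_inv P)"
    by (simp add: matrix_inv_inverse[OF P])
  also have "\<dots> = transpose (P ** matrix_inv P) ** matrix_inv P"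
    by (simp add: matrix_transpose_mul sym matrix_mul_assoc)
  finally show ?thesis
    by (simp add: matrix_inv_inverse[OF P])
qed

section \<open>Comparison of Riccati solutions\<close>

text \<open>With F = A - P C^T C and D = P - S, subtracting the equations gives F D + D F^T = - D
  C^T C D; then \<open>lyapunov_nonneg\<close> applies to the Hurwitz matrix F^T.\<close>

lemma stabilizing_riccati_solution_maximal:
  fixes A P S W :: "real^'n^'n" and C :: "real^'n^'m"
  assumes P: "transpose P = P" and S: "transpose S = S"
    and ricP: "A ** P + P ** transpose A - P ** transpose C ** C ** P + W = 0"
    and ricS: "A ** S + S ** transpose A - S ** transpose C ** C ** S + W = 0"
    and stab: "hurwitz (A - P ** transpose C ** C)"
  shows "0 \<le> x \<bullet> ((P - S) *v x)"
proof (rule lyapunov_nonneg[OF hurwitz_transpose[OF stab]])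
  let ?F = "A - P ** transpose C ** C" and ?D = "P - S"
  show D: "transpose ?D = ?D"
    by (simp add: transpose_add_diff_minus P S)
  have F: "transpose ?F = transpose A - transpose C ** C ** P"
    by (simp add: transpose_add_diff_minus matrix_transpose_mul P matrix_mul_assoc)
  have "?F ** ?D + ?D ** transpose ?F + ?D ** transpose C ** C ** ?D
      = (A ** P + P ** transpose A - P ** transpose C ** C ** P + W)
      - (A ** S + S ** transpose A - S ** transpose C ** C ** S + W)"
    unfolding F matrix_eq by (simp add: apply_matrix del: transpose_matrix_vector)
  then have eq: "?F ** ?D + ?D ** transpose ?F + ?D ** transpose C ** C ** ?D = 0"
    by (simp add: ricP ricS)
  fix x
  have "x \<bullet> ((?F ** ?D + ?D ** transpose ?F + ?D ** transpose C ** C ** ?D) *v x) = 0"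
    unfolding eq by simp
  moreover have "x \<bullet> (?F *v (?D *v x)) = x \<bullet> (?D *v (transpose ?F *v x))"
    unfolding inner_matrix_transpose[of x ?F] inner_symmetric_matrix[OF D, of x]
    by (rule inner_commute)
  moreover have "x \<bullet> (?D *v (transpose C *v (C *v (?D *v x)))) = (C *v (?D *v x)) \<bullet> (C *v (?D *v x))"
    unfolding inner_symmetric_matrix[OF D] inner_matrix_transpose[of _ "transpose C"] transpose_transpose ..
  ultimately show "x \<bullet> (?D *v (transpose ?F *v x)) \<le> 0"
    using inner_ge_zero[of "C *v (?D *v x)"]
    unfolding matrix_vector_mult_add_rdistrib matrix_vector_mul_assoc[symmetric] inner_add_right
    by linarith
qed

text \<open>Each solution dominates the other, so the difference has zero quadratic form and, being
  symmetric, is zero.\<close>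

lemma stabilizing_riccati_solution_unique:
  fixes A P S W :: "real^'n^'n" and C :: "real^'n^'m"
  assumes P: "transpose P = P" and S: "transpose S = S"
    and ricP: "A ** P + P ** transpose A - P ** transpose C ** C ** P + W = 0"
    and ricS: "A ** S + S ** transpose A - S ** transpose C ** C ** S + W = 0"
    and stabP: "hurwitz (A - P ** transpose C ** C)"
    and stabS: "hurwitz (A - S ** transpose C ** C)"
  shows "P = S"
proof -
  have ge: "0 \<le> x \<bullet> ((P - S) *v x)" for x
    by (rule stabilizing_riccati_solution_maximal[OF P S ricP ricS stabP])
  moreover have "0 \<le> x \<bullet> ((S - P) *v x)" for x
    by (rule stabilizing_riccati_solution_maximal[OF S P ricS ricP stabS])
  ultimately have zero: "x \<bullet> ((P - S) *v x) = 0" for x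
    by (metis (no_types) antisym inner_minus_right minus_diff_eq minus_matrix_vector_mult neg_0_le_iff_le)
  have "transpose (P - S) = P - S"
    by (simp add: transpose_add_diff_minus P S)
  then have "x \<bullet> ((P - S) *v y) = 0" for x y
    by (intro psd_form_kernel[OF bilinear_matrix, of "P - S", OF _ ge zero])
      (metis inner_symmetric_matrix inner_commute)
  then have "(P - S) *v y = 0" for y
    using inner_eq_zero_iff by blast
  then have "P *v y = S *v y" for y
    by (simp add: matrix_vector_mult_diff_rdistrib)
  then show ?thesis
    by (simp add: matrix_eq)
qed

section \<open>The two Riccati solutions and the controller\<close>

lemma filter_solution_eq_matrix_inv:
  fixes J R Q A Pf :: "real^'n^'n" and B :: "real^'m^'n" and C :: "real^'n^'m"
  assumes J: "transpose J = - J" and R: "pos_semidef R" and Q: "pos_def Q"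
    and A: "A = (J - R) ** Q" and C: "C = transpose B ** Q"
    and obs: "observable A C" and Pf: "stabilizing_filter_solution R A B C Pf"
  shows "Pf = matrix_inv Q"
proof -
  let ?S = "matrix_inv Q"
  have Qsym: "transpose Q = Q" and Rsym: "transpose R = R"
    using Q R by (auto simp: pos_def_def pos_semidef_def)
  note inv = pos_def_invertible[OF Q]
  have S: "transpose ?S = ?S"
    by (rule matrix_inv_symmetric[OF inv Qsym])
  note SQ = matrix_inv_inverse[OF inv]
  have SQ_apply: "?S *v (Q *v x) = x" "Q *v (?S *v x) = x" for x
    by (simp_all add: matrix_vector_mul_assoc SQ)
  have CT: "transpose C = Q ** B"
    by (simp add: C matrix_transpose_mul Qsym)
  have AT: "transpose A = Q ** (- J - R)"
    by (simp add: A matrix_transpose_mul Qsym transpose_add_diff_minus J Rsym)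
  have R2: "(2 *\<^sub>R R) *v x = R *v x + R *v x" for x
    by (simp only: scaleR_2 matrix_vector_mult_add_rdistrib)
  \<comment> \<open>With S = Q^-1, A S = J - R and S A^T = - J - R add up to -2 R, while S C^T C S =
    B B^T.\<close>
  have ric: "A ** ?S + ?S ** transpose A - ?S ** transpose C ** C ** ?S
      + (B ** transpose B + 2 *\<^sub>R R) = 0"
    unfolding CT AT unfolding A C matrix_eq
    by (simp add: apply_matrix SQ_apply R2 del: transpose_matrix_vector)
  have SC: "?S ** transpose C ** C = B ** C"
    unfolding CT matrix_eq by (simp add: apply_matrix SQ_apply)
  \<comment> \<open>Here A - B C = (J - R - B B^T) Q: \<open>J\<close> preserves the energy,
    \<open>R\<close> cannot increase it, and the feedback removes |C x|^2.\<close>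
  have "hurwitz (A - B ** C)"
  proof (rule hurwitz_if_dissipative[OF obs Q])
    show "(A - B ** C) *v x = A *v x" if "C *v x = 0" for x
      by (simp add: apply_matrix that)
    show "x \<bullet> (Q *v ((A - B ** C) *v x)) \<le> - ((C *v x) \<bullet> (C *v x))" for x
    proof -
      let ?y = "Q *v x"
      have "x \<bullet> (Q *v ((A - B ** C) *v x)) = ?y \<bullet> (J *v ?y) - ?y \<bullet> (R *v ?y) - ?y \<bullet> (B *v (C *v x))"
        by (simp add: inner_symmetric_matrix[OF Qsym] A apply_matrix inner_diff_right)
      moreover have "?y \<bullet> (J *v ?y) = 0"
        using inner_matrix_transpose[of ?y J ?y]
        by (simp add: J minus_matrix_vector_mult inner_commute del: transpose_matrix_vector)
      moreover have "0 \<le> ?y \<bullet> (R *v ?y)"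
        using R by (simp add: pos_semidef_def)
      moreover have "?y \<bullet> (B *v (C *v x)) = (C *v x) \<bullet> (C *v x)"
        unfolding inner_matrix_transpose[of ?y B] by (simp add: C apply_matrix del: transpose_matrix_vector)
      ultimately show ?thesis
        by simp
    qed
  qed
  then have "hurwitz (A - ?S ** transpose C ** C)"
    by (simp add: SC)
  moreover have "transpose Pf = Pf" "hurwitz (A - Pf ** transpose C ** C)"
    "A ** Pf + Pf ** transpose A - Pf ** transpose C ** C ** Pf + (B ** transpose B + 2 *\<^sub>R R) = 0"
    using Pf by (simp_all add: stabilizing_filter_solution_def add.assoc)
  ultimately show ?thesis
    using stabilizing_riccati_solution_unique[OF _ S _ ric] by blast
qed

text \<open>Along the closed loop, the derivative of x . P x is - |B^T P x|^2 - |C x|^2, which makes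
  \<open>P\<close> semidefinite. Its kernel is invariant under \<open>A\<close> and invisible to
  \<open>C\<close>, hence trivial.\<close>

lemma control_solution_pos_def:
  fixes A P :: "real^'n^'n" and B :: "real^'m^'n" and C :: "real^'n^'m"
  assumes obs: "observable A C" and P: "stabilizing_control_solution A B C P"
  shows "pos_def P"
proof -
  have sym: "transpose P = P" and stab: "hurwitz (A - B ** transpose B ** P)"
    and ric: "transpose A ** P + P ** A - P ** B ** transpose B ** P + transpose C ** C = 0"
    using P by (auto simp: stabilizing_control_solution_def)
  have ric_apply: "transpose A *v (P *v x) + P *v (A *v x)
      - P *v (B *v (transpose B *v (P *v x))) + transpose C *v (C *v x) = 0" for x
    using arg_cong[OF ric, of "\<lambda>M. M *v x"]
    by (simp add: apply_matrix del: transpose_matrix_vector)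
  let ?u = "\<lambda>x. transpose B *v (P *v x)"
  have energy: "2 * (x \<bullet> (P *v (A *v x))) = ?u x \<bullet> ?u x - (C *v x) \<bullet> (C *v x)" for x
  proof -
    have "x \<bullet> (transpose A *v (P *v x)) + x \<bullet> (P *v (A *v x))
      - x \<bullet> (P *v (B *v ?u x)) + x \<bullet> (transpose C *v (C *v x)) = 0"
      using arg_cong[OF ric_apply[of x], of "inner x"]
      unfolding inner_add_right inner_diff_right inner_zero_right .
    moreover have "x \<bullet> (transpose A *v (P *v x)) = x \<bullet> (P *v (A *v x))"
      unfolding inner_matrix_transpose[of x "transpose A"] transpose_transpose
        inner_symmetric_matrix[OF sym, of x] by (rule inner_commute)
    moreover have "x \<bullet> (P *v (B *v ?u x)) = ?u x \<bullet> ?u x"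
      unfolding inner_symmetric_matrix[OF sym, of x] inner_matrix_transpose[of _ B] ..
    moreover have "x \<bullet> (transpose C *v (C *v x)) = (C *v x) \<bullet> (C *v x)"
      unfolding inner_matrix_transpose[of x "transpose C"] transpose_transpose ..
    ultimately show ?thesis
      by linarith
  qed
  have nonneg: "0 \<le> x \<bullet> (P *v x)" for x
  proof (rule lyapunov_nonneg[OF stab sym])
    fix x
    have "x \<bullet> (P *v ((A - B ** transpose B ** P) *v x)) = x \<bullet> (P *v (A *v x)) - x \<bullet> (P *v (B *v ?u x))"
      by (simp add: apply_matrix inner_diff_right del: transpose_matrix_vector)
    also have "x \<bullet> (P *v (B *v ?u x)) = ?u x \<bullet> ?u x"
      unfolding inner_symmetric_matrix[OF sym, of x] inner_matrix_transpose[of _ B] ..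
    finally show "x \<bullet> (P *v ((A - B ** transpose B ** P) *v x)) \<le> 0"
      using energy[of x] inner_ge_zero[of "?u x"] inner_ge_zero[of "C *v x"] by linarith
  qed
  have out: "C *v x = 0" if "P *v x = 0" for x
    using energy[of x] that
    by (simp add: inner_symmetric_matrix[OF sym])
  have ker: "x = 0" if "P *v x = 0" for x
  proof (rule observable_invariant_kernel[OF obs _ out that])
    \<comment> \<open>On a kernel vector every other term of the Riccati equation vanishes.\<close>
    show "P *v (A *v x) = 0" if "P *v x = 0" for x
      using ric_apply[of x] that out[OF that] by simp
  qed
  have "x = 0" if "x \<bullet> (P *v x) = 0" for x
  proof -
    have "y \<bullet> (P *v x) = 0" for y
      using psd_form_kernel[OF bilinear_matrix _ nonneg that, of y] 
      by (metis inner_symmetric_matrix[OF sym] inner_commute)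
    then show ?thesis
      using ker inner_eq_zero_iff by blast
  qed
  with nonneg show ?thesis
    unfolding pos_def_def using sym by (metis less_le)
qed

text \<open>The left-hand side is the Riccati expression multiplied by X = P^-1 from both sides;
  expanding the square cancels the cross terms of B C X and its transpose.\<close>

lemma lqg_controller_dissipation:
  fixes A P Q X :: "real^'n^'n" and B :: "real^'m^'n" and C :: "real^'n^'m"
  assumes P: "transpose P = P" and Q: "transpose Q = Q" and C: "C = transpose B ** Q"
    and ric: "transpose A ** P + P ** A - P ** B ** transpose B ** P + transpose C ** C = 0"
    and X: "transpose X = X" "P ** X = mat 1" "X ** P = mat 1"
    and K: "K = A - B ** transpose B ** P - B ** C"
  shows "K ** X + X ** transpose K
    + (X ** Q + mat 1) ** B ** transpose B ** transpose (X ** Q + mat 1) = 0"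
proof -
  have X_apply: "X *v (P *v x) = x" "P *v (X *v x) = x" for x
    by (simp_all add: matrix_vector_mul_assoc X)
  have KT: "transpose K = transpose A - P ** B ** transpose B - transpose C ** transpose B"
    by (simp add: K transpose_add_diff_minus matrix_transpose_mul P matrix_mul_assoc)
  have XQ: "transpose (X ** Q + mat 1) = Q ** X + mat 1"
    by (simp add: transpose_add_diff_minus matrix_transpose_mul X Q)
  have CT: "transpose C = Q ** B"
    by (simp add: C matrix_transpose_mul Q)
  have "K ** X + X ** transpose K
      + (X ** Q + mat 1) ** B ** transpose B ** transpose (X ** Q + mat 1)
    = X ** (transpose A ** P + P ** A - P ** B ** transpose B ** P + transpose C ** C) ** X"
    unfolding XQ KT unfolding K CT unfolding C matrix_eq
    by (simp add: apply_matrix X_apply del: transpose_matrix_vector)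
  then show ?thesis
    by (simp add: ric)
qed

theorem theorem1:
  fixes J R Q A Pc Pf Ac Jc Rc :: "real^'n^'n"
    and B Bc :: "real^'m^'n"
    and C Cc :: "real^'n^'m"
  assumes "transpose J = - J" and "pos_semidef R" and "pos_def Q"
    and "A = (J - R) ** Q" and "C = transpose B ** Q"
    and "controllable A B" and "observable A C"
    and "stabilizing_control_solution A B C Pc"
    and "stabilizing_filter_solution R A B C Pf"
    and "Ac = A - B ** transpose B ** Pc - Pf ** transpose C ** C"
    and "Bc = Pf ** transpose C"
    and "Cc = transpose B ** Pc"
    and "Jc = (1/2) *\<^sub>R (Ac ** matrix_inv Pc - matrix_inv Pc ** transpose Ac)"
    and "Rc = (1/2) *\<^sub>R ((matrix_inv Pc ** Q + mat 1) ** B ** transpose B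
                           ** transpose (matrix_inv Pc ** Q + mat 1))"
  shows "port_Hamiltonian Ac Bc Cc
       \<and> invertible Pc
       \<and> Bc = B
       \<and> pH_realization (\<lambda>x. 1/2 * (x \<bullet> (Pc *v x))) Jc Rc Pc Ac Bc Cc"
proof -
  let ?X = "matrix_inv Pc" and ?T = "matrix_inv Pc ** Q + mat 1"
  have Q: "transpose Q = Q"
    using assms(3) by (simp add: pos_def_def)
  have Pf: "Pf = matrix_inv Q"
    by (rule filter_solution_eq_matrix_inv[OF assms(1-5,7,9)])
  have Bc: "Bc = B"
    using matrix_inv_inverse(2)[OF pos_def_invertible[OF assms(3)]]
    by (simp add: assms(11,5) Pf matrix_transpose_mul Q matrix_mul_assoc)
  have Pc: "pos_def Pc"
    by (rule control_solution_pos_def[OF assms(7,8)])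
  then have Psym: "transpose Pc = Pc"
    by (simp add: pos_def_def)
  note inv = pos_def_invertible[OF Pc]
  note X = matrix_inv_symmetric[OF inv Psym] matrix_inv_inverse[OF inv]
  have Ac: "Ac = A - B ** transpose B ** Pc - B ** C"
    using Bc by (simp add: assms(10,11))
  have "Ac ** ?X + ?X ** transpose Ac + ?T ** B ** transpose B ** transpose ?T = 0"
    using assms(8) unfolding stabilizing_control_solution_def
    by (intro lqg_controller_dissipation[OF Psym Q assms(5) _ X Ac]) blast
  \<comment> \<open>Thus \<open>Rc\<close> is minus the symmetric part of Ac Pc^-1, of which
    \<open>Jc\<close> is the skew part by definition.\<close>
  then have Rc: "2 *\<^sub>R Rc = - (Ac ** ?X + ?X ** transpose Ac)"
    by (simp add: assms(14) add_eq_0_iff)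
  have "2 *\<^sub>R (Jc - Rc) = 2 *\<^sub>R (Ac ** ?X)"
    unfolding scaleR_diff_right Rc by (simp add: assms(13) scaleR_2)
  then have "Jc - Rc = Ac ** ?X"
    by simp
  then have "(Jc - Rc) ** Pc = Ac"
    by (simp add: matrix_mul_assoc[symmetric] X)
  moreover have "transpose Jc = - Jc"
    unfolding assms(13) transpose_scalar transpose_add_diff_minus matrix_transpose_mul X
    by (simp add: scaleR_diff_right)
  moreover have "pos_semidef Rc"
    unfolding pos_semidef_def
  proof (intro conjI allI)
    show "transpose Rc = Rc"
      unfolding assms(14) by (simp add: transpose_scalar matrix_transpose_mul matrix_mul_assoc)
    fix x
    let ?z = "transpose B *v (transpose ?T *v x)"
    \<comment> \<open>\<open>Rc\<close> is half the Gram matrix (T B) (T B)^T.\<close>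
    have "x \<bullet> (Rc *v x) = (1/2) * (x \<bullet> (?T *v (B *v ?z)))"
      unfolding assms(14) scaleR_matrix_vector_assoc[symmetric] matrix_vector_mul_assoc[symmetric]
      by simp
    also have "x \<bullet> (?T *v (B *v ?z)) = ?z \<bullet> ?z"
      unfolding inner_matrix_transpose[of x ?T] inner_matrix_transpose[of _ B] ..
    finally show "0 \<le> x \<bullet> (Rc *v x)"
      using inner_ge_zero[of ?z] by linarith
  qed
  ultimately have "pH_realization (\<lambda>x. 1/2 * (x \<bullet> (Pc *v x))) Jc Rc Pc Ac Bc Cc"
    using Pc by (simp add: pH_realization_def assms(12) Bc)
  then show ?thesis
    using inv Bc unfolding port_Hamiltonian_def by blast
qed

end
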